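(* Let $(k_j)_{j\in\{2,\dots,N-1\}}$ and $(f_j)_{j\in\{2,\dots,N-1\}}$ be two discrete functions (finite sequences of real numbers), and let $(\theta_j)$ and $(\phi_j)$ be the turning angles obtained as their respective partial sums, $\theta_j=\sum_{r=2}^{j}k_r$ and $\phi_j=\sum_{r=2}^{j}f_r$ for $2\leq j\leq N-1$. The following conditions are equivalent. (0) The polyline with curvature $(k_j)+\lambda(f_j)$ is closed for all $\lambda\in\mathbb{R}$. (1) $\sum_{1<j<N}\mathrm{e}^{i\theta_j}\phi_j^n=0$ for all $n\in\mathbb{N}_0$. (2) $\sum_{j\in\phi^{-1}(a)}\mathrm{e}^{i\theta_j}=0$ for all $a\in\mathbb{R}$.
   Context: An arc-length parametrized polyline is a finite sequence of vertices $(v_j)_{j\in\{1,\dots,N\}}\subset\mathbb{C}$ with $\|v_{j+1}-v_j\|=1$ for $1\leq j\leq N-1$. Its curvature at a non-extreme vertex $v_j$ ($2\leq j\leq N-1$) is the counter-clockwise angle between $v_j-v_{j-1}$ and $v_{j+1}-v_j$. Conversely, given real numbers $(\kappa_j)_{2\leq j\leq N-1}$, the polyline with curvature $(\kappa_j)$ is, up to rigid motions, the one given by $v_1=0$, $v_2=1$, $v_j=v_{j-1}+\mathrm{e}^{i\vartheta_{j-1}}$ for $3\leq j\leq N$, where $\vartheta_j=\sum_{r=2}^{j}\kappa_r$ is the turning angle at $v_j$. A polyline is closed if $v_1=v_N$. For $a\in\mathbb{R}$, $\phi^{-1}(a)=\{j\in\{2,\dots,N-1\}:\phi_j=a\}$;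 an empty sum is $0$. $\mathbb{N}_0=\{0,1,2,\dots\}$, and a zeroth power is $1$.
   Formalization: In (1) the sum and in (2) the level set run over 1 ≤ j < N, with θ_1 = φ_1 = 0, instead of 1 < j < N: the first edge must be counted, since v_N − v_1 = 1 + Σ_{1<j<N} e^{iθ_j}; as printed, (0) and (1) exclude each other (e.g. the unit square with f = 0). *)

theory Defs
  imports Complex_Main
begin

text \<open>
  Sequences indexed by \<open>{2..N-1}\<close> or \<open>{1..N}\<close> are functions on \<open>nat\<close>; only their values on
  that index set matter.
\<close>

text \<open>
  \<open>turning_angle \<kappa> 1\<close> is an empty sum, hence \<open>0\<close>: the direction of the first edge.
\<close>

definition turning_angle :: "(nat \<Rightarrow> real) \<Rightarrow> nat \<Rightarrow> real" where
  "turning_angle \<kappa> j = (\<Sum>r = 2..j. \<kappa> r)"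

text \<open>Vertices are numbered from \<open>1\<close>; the value at \<open>0\<close> is junk.\<close>

fun polyline :: "(nat \<Rightarrow> real) \<Rightarrow> nat \<Rightarrow> complex" where
  "polyline \<kappa> 0 = 0"
| "polyline \<kappa> (Suc 0) = 0"
| "polyline \<kappa> (Suc (Suc 0)) = 1"
| "polyline \<kappa> (Suc (Suc (Suc m))) =
     polyline \<kappa> (Suc (Suc m)) + cis (turning_angle \<kappa> (Suc (Suc m)))"

definition closed_polyline :: "nat \<Rightarrow> (nat \<Rightarrow> complex) \<Rightarrow> bool" where
  "closed_polyline N v \<longleftrightarrow> v 1 = v N"

text \<open>
  The polyline \<open>v\<^sub>1, \<dots>, v\<^sub>N\<close> has the \<open>N - 1\<close> edges
  \<open>v\<^sub>j\<^sub>+\<^sub>1 - v\<^sub>j = cis (turning_angle \<kappa> j)\<close> for \<open>1 \<le> j < N\<close>. The first edge, of turning angle \<open>0\<close>,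
  has to be counted in a closing condition, so the index set is \<open>{1..<N}\<close> and not \<open>{1<..<N}\<close>:
  summing over \<open>1 < j < N\<close> only would express \<open>v\<^sub>N = v\<^sub>2\<close> instead of \<open>v\<^sub>N = v\<^sub>1\<close>.
\<close>

definition level_set :: "nat \<Rightarrow> (nat \<Rightarrow> real) \<Rightarrow> real \<Rightarrow> nat set" where
  "level_set N \<phi> a = {j \<in> {1..<N}. \<phi> j = a}"

end

theory Submission
  imports Defs
begin

text \<open>
  With \<open>\<theta>\<close> and \<open>\<phi>\<close> the turning angles of \<open>k\<close> and \<open>f\<close>, turning angles add up linearly, so the end
  point of the polyline with curvature \<open>k + t f\<close> is the exponential sum
  \<open>\<Sum>\<^sub>j e\<^bsup>i\<theta>\<^sub>j\<^esup> e\<^bsup>it\<phi>\<^sub>j\<^esup>\<close>, the starting point being \<open>0\<close>. From there on only the weights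
  \<open>c\<^sub>j = e\<^bsup>i\<theta>\<^sub>j\<^esup>\<close> and the nodes \<open>\<phi>\<^sub>j\<close> matter, and all three conditions say that the finite complex
  measure \<open>\<Sum>\<^sub>j c\<^sub>j \<delta>\<^bsub>\<phi>\<^sub>j\<^esub>\<close> on the real line is zero: through its Fourier transform, through its
  moments, and through its atoms.

  If the transform vanishes identically, so do its derivatives, and these are the moments up to powers
  of \<open>i\<close> (\<open>moments_eq_0_if_cis_sums_eq_0\<close>). If the moments vanish, the measure annihilates all
  polynomials, and a polynomial that vanishes at all nodes but one isolates an atom
  (\<open>level_sum_eq_0_if_moments_eq_0\<close>). If the atoms vanish, the measure annihilates every function
  (\<open>weighted_sum_eq_0_if_level_sums_eq_0\<close>), in particular the powers and the exponentials.
\<close>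

lemma weighted_sum_eq_0_if_level_sums_eq_0:
  fixes c :: "'i \<Rightarrow> 'a::comm_ring_1" and x :: "'i \<Rightarrow> 'b" and g :: "'b \<Rightarrow> 'a"
  assumes "finite A" and levels: "\<And>a. (\<Sum>j | j \<in> A \<and> x j = a. c j) = 0"
  shows "(\<Sum>j\<in>A. c j * g (x j)) = 0"
proof -
  have "(\<Sum>j\<in>A. c j * g (x j)) = (\<Sum>a\<in>x ` A. \<Sum>j | j \<in> A \<and> x j = a. c j * g (x j))"
    using assms(1) by (rule sum.image_gen)
  also have "\<dots> = (\<Sum>a\<in>x ` A. (\<Sum>j | j \<in> A \<and> x j = a. c j) * g a)"
    by (simp add: sum_distrib_right)
  also have "\<dots> = 0"
    by (simp add: levels)
  finally show ?thesis .
qed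

text \<open>
  By linearity, vanishing moments give vanishing integrals of all polynomials; the ones with given
  roots are reached by adding one linear factor at a time. The extra power keeps the induction going,
  because \<open>(x - b) x\<^sup>n = x\<^bsup>n+1\<^esup> - b x\<^sup>n\<close>.
\<close>

lemma weighted_root_product_eq_0_if_moments_eq_0:
  fixes c x :: "'i \<Rightarrow> 'a::comm_ring_1"
  assumes "finite B" and moments: "\<And>n. (\<Sum>j\<in>A. c j * x j ^ n) = 0"
  shows "(\<Sum>j\<in>A. c j * (\<Prod>b\<in>B. x j - b) * x j ^ n) = 0"
  using assms(1)
proof (induction B arbitrary: n rule: finite_induct)
  case empty
  then show ?case by (simp add: moments)
next
  case (insert b B)
  have "(\<Sum>j\<in>A. c j * (\<Prod>b\<in>insert b B. x j - b) * x j ^ n)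
      = (\<Sum>j\<in>A. c j * (\<Prod>b\<in>B. x j - b) * x j ^ Suc n)
        - b * (\<Sum>j\<in>A. c j * (\<Prod>b\<in>B. x j - b) * x j ^ n)"
    using insert.hyps by (simp add: sum_distrib_left sum_subtractf [symmetric] algebra_simps)
  then show ?case by (simp only: insert.IH) simp
qed

lemma level_sum_eq_0_if_moments_eq_0:
  fixes c x :: "'i \<Rightarrow> 'a::idom"
  assumes "finite A" and moments: "\<And>n. (\<Sum>j\<in>A. c j * x j ^ n) = 0"
  shows "(\<Sum>j | j \<in> A \<and> x j = a. c j) = 0"
proof -
  define B where "B = x ` A - {a}"
  have "finite B" using assms(1) by (simp add: B_def)
  define p where "p y = (\<Prod>b\<in>B. y - b)" for y
  have p_a: "p a \<noteq> 0"
    using \<open>finite B\<close> by (simp add: p_def B_def)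
  have p_other: "p (x j) = 0" if "j \<in> A" "x j \<noteq> a" for j
    unfolding p_def using \<open>finite B\<close> that by (intro prod_zero) (auto simp: B_def)
  have "(\<Sum>j | j \<in> A \<and> x j = a. c j) * p a = (\<Sum>j | j \<in> A \<and> x j = a. c j * p (x j))"
    by (simp add: sum_distrib_right)
  also have "\<dots> = (\<Sum>j\<in>A. c j * p (x j))"
    using assms(1) p_other by (intro sum.mono_neutral_left) auto
  also have "\<dots> = 0"
    using weighted_root_product_eq_0_if_moments_eq_0 [OF \<open>finite B\<close> moments, where n = 0]
    by (simp add: p_def)
  finally show ?thesis using p_a by simp
qed

text \<open>
  Differentiating the exponential sum multiplies each term by \<open>i x\<^sub>j\<close>; hence the vanishing for all
  \<open>t\<close>, and not only at \<open>t = 0\<close>, passes from each power to the next.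
\<close>

lemma moments_eq_0_if_cis_sums_eq_0:
  fixes c :: "'i \<Rightarrow> complex" and x :: "'i \<Rightarrow> real"
  assumes zero: "\<And>t. (\<Sum>j\<in>A. c j * cis (t * x j)) = 0"
  shows "(\<Sum>j\<in>A. c j * complex_of_real (x j) ^ n) = 0"
proof -
  have "(\<Sum>j\<in>A. c j * complex_of_real (x j) ^ n * cis (t * x j)) = 0" for t
  proof (induction n arbitrary: t)
    case 0
    then show ?case by (simp add: zero)
  next
    case (Suc n)
    let ?F = "\<lambda>t. \<Sum>j\<in>A. c j * complex_of_real (x j) ^ n * cis (t * x j)"
    have "((\<lambda>t. cis (t * x j)) has_vector_derivative \<i> * complex_of_real (x j) * cis (t * x j)) (at t)"
      for j
      unfolding has_vector_derivative_complex_iff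
      by (auto intro!: derivative_eq_intros)
    then have "(?F has_vector_derivative
        (\<Sum>j\<in>A. c j * complex_of_real (x j) ^ n * (\<i> * complex_of_real (x j) * cis (t * x j)))) (at t)"
      by (intro has_vector_derivative_sum has_vector_derivative_mult_right)
    then have "((\<lambda>t. 0) has_derivative (\<lambda>h. h *\<^sub>R
        (\<Sum>j\<in>A. c j * complex_of_real (x j) ^ n * (\<i> * complex_of_real (x j) * cis (t * x j))))) (at t)"
      by (simp only: Suc has_vector_derivative_def)
    from fun_cong [OF has_derivative_unique [OF this has_derivative_const], of 1]
    have "(\<Sum>j\<in>A. c j * complex_of_real (x j) ^ n *
        (\<i> * complex_of_real (x j) * cis (t * x j))) = 0"
      by simp
    then have "\<i> * (\<Sum>j\<in>A. c j * complex_of_real (x j) ^ Suc n * cis (t * x j)) = 0"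
      by (simp add: sum_distrib_left mult_ac)
    then show ?case by simp
  qed
  from this [of 0] show ?thesis by simp
qed

lemma turning_angle_linear:
  "turning_angle (\<lambda>j. k j + t * f j) j = turning_angle k j + t * turning_angle f j"
  by (simp add: turning_angle_def sum.distrib sum_distrib_left)

lemma polyline_eq_sum_cis:
  "polyline \<kappa> N = (\<Sum>j\<in>{1..<N}. cis (turning_angle \<kappa> j))"
  by (induction \<kappa> N rule: polyline.induct) (simp_all add: turning_angle_def)

lemma closed_polyline_iff_cis_sum:
  "closed_polyline N (polyline (\<lambda>j. k j + t * f j)) \<longleftrightarrow>
    (\<Sum>j\<in>{1..<N}. cis (turning_angle k j) * cis (t * turning_angle f j)) = 0"
  by (auto simp: closed_polyline_def polyline_eq_sum_cis turning_angle_linear cis_mult)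

theorem theorem5p1:
  fixes N :: nat and k f :: "nat \<Rightarrow> real"
  assumes "N \<ge> 1"
  shows "((\<forall>t::real. closed_polyline N (polyline (\<lambda>j. k j + t * f j))) \<longleftrightarrow>
            (\<forall>n::nat. (\<Sum>j\<in>{1..<N}. cis (turning_angle k j) * complex_of_real (turning_angle f j) ^ n) = 0))
       \<and> ((\<forall>n::nat. (\<Sum>j\<in>{1..<N}. cis (turning_angle k j) * complex_of_real (turning_angle f j) ^ n) = 0) \<longleftrightarrow>
            (\<forall>a::real. (\<Sum>j\<in>level_set N (turning_angle f) a. cis (turning_angle k j)) = 0))"
    (is "(?closed \<longleftrightarrow> ?moments) \<and> (?moments \<longleftrightarrow> ?levels)")
proof -
  have closed_moments: ?moments if ?closed
    using that unfolding closed_polyline_iff_cis_sum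
    by (intro allI moments_eq_0_if_cis_sums_eq_0) blast
  have moments_levels: ?levels if ?moments
  proof
    fix a
    have "(\<Sum>j | j \<in> {1..<N} \<and> complex_of_real (turning_angle f j) = complex_of_real a.
        cis (turning_angle k j)) = 0"
      using that by (intro level_sum_eq_0_if_moments_eq_0) auto
    then show "(\<Sum>j\<in>level_set N (turning_angle f) a. cis (turning_angle k j)) = 0"
      by (simp add: level_set_def)
  qed
  have levels_any: "(\<Sum>j\<in>{1..<N}. cis (turning_angle k j) * g (turning_angle f j)) = 0"
    if ?levels for g :: "real \<Rightarrow> complex"
    using that by (intro weighted_sum_eq_0_if_level_sums_eq_0) (auto simp: level_set_def)
  have levels_moments: ?moments if ?levels
    using levels_any [OF that, of "\<lambda>y. complex_of_real y ^ n" for n] by blast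
  have levels_closed: ?closed if ?levels
    using levels_any [OF that, of "\<lambda>y. cis (t * y)" for t]
    unfolding closed_polyline_iff_cis_sum by blast
  show ?thesis
    using closed_moments moments_levels levels_moments levels_closed by blast
qed

end
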